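(* Let $G_1$ be a connected graph on $n_1$ vertices and $m_1$ edges and let $G_2$ be a graph on $n_2$ vertices and $m_2$ edges, with vertex degrees $d_1,\dots,d_{n_2}$ and Laplacian eigenvalues $\mu_1(G_2),\dots,\mu_{n_2}(G_2)$. Let $Q=L_{G_2}+2I_{n_2}$, $D_{G_2}=\mathrm{diag}(d_1,\dots,d_{n_2})$, $A_{G_2}$ the adjacency matrix of $G_2$, and $\pi=(d_1,\dots,d_{n_2})^T$. Then \begin{align*} Kf(G_1\diamondsuit G_2)&=n_1(1+n_2+m_2)\Big[\frac{n_1m_2}{2}+\frac{n_1}{2}\big(\mathrm{tr}(Q^{-1}A_{G_2})+\mathrm{tr}(Q^{-1}D_{G_2})\big)+2n_1\sum_{i=1}^{n_2}\frac{1}{\mu_i(G_2)+2}\\ &\qquad+\frac{m_2+n_2+1}{n_1}Kf(G_1)\Big]-\frac{n_1}{2}\,\pi^TQ^{-1}\pi-\frac{5n_1m_2+2n_1n_2}{2}. \end{align*}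
   Context: All graphs are simple and undirected; $L_G=D_G-A_G$ is the Laplacian matrix. The resistance distance between two vertices of a connected graph is the effective resistance between them when every edge is a unit resistor, and the Kirchhoff index $Kf(G)$ of a connected graph is the sum of resistance distances over all unordered pairs of distinct vertices. The corona-vertex of the subdivision graph $G_1\diamondsuit G_2$ is obtained from $G_1$ and $|V(G_1)|$ vertex-disjoint copies of the subdivision graph $S(G_2)$ (the graph obtained from $G_2$ by inserting a new vertex into every edge) by joining the $i$-th vertex of $G_1$ to every original vertex (i.e. vertex coming from $V(G_2)$, not a subdivision vertex) of the $i$-th copy. It has $n_1(1+n_2+m_2)$ vertices. *)

theory Defs
  imports "Jordan_Normal_Form.Gauss_Jordan_Elimination" "Jordan_Normal_Form.Char_Poly"
begin

definition simple_graph :: "'a set \<Rightarrow> ('a \<Rightarrow> 'a \<Rightarrow> bool) \<Rightarrow> bool" where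
  "simple_graph V E \<longleftrightarrow> finite V \<and> (\<forall>u v. E u v \<longrightarrow> u \<in> V \<and> v \<in> V)
     \<and> (\<forall>u v. E u v \<longrightarrow> E v u) \<and> (\<forall>u. \<not> E u u)"

definition connected_graph :: "'a set \<Rightarrow> ('a \<Rightarrow> 'a \<Rightarrow> bool) \<Rightarrow> bool" where
  "connected_graph V E \<longleftrightarrow> simple_graph V E \<and> V \<noteq> {} \<and> (\<forall>u\<in>V. \<forall>v\<in>V. E\<^sup>*\<^sup>* u v)"

definition graph_edges :: "'a set \<Rightarrow> ('a \<Rightarrow> 'a \<Rightarrow> bool) \<Rightarrow> 'a set set" where
  "graph_edges V E = {{u, v} | u v. u \<in> V \<and> v \<in> V \<and> E u v}"

definition degree :: "'a set \<Rightarrow> ('a \<Rightarrow> 'a \<Rightarrow> bool) \<Rightarrow> 'a \<Rightarrow> nat" where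
  "degree V E w = card {y \<in> V. E w y}"

(* Resistance distance: the potential difference x u - x v, where x is a vertex
   potential solving the Laplacian system L x = e_u - e_v (a unit current
   injected at u and extracted at v).  For a connected graph all solutions
   differ by a constant, so this is well defined. *)
definition resistance :: "'a set \<Rightarrow> ('a \<Rightarrow> 'a \<Rightarrow> bool) \<Rightarrow> 'a \<Rightarrow> 'a \<Rightarrow> real" where
  "resistance V E u v =
     (let x = (SOME x :: 'a \<Rightarrow> real. \<forall>w\<in>V.
                 real (degree V E w) * x w - (\<Sum>y\<in>{y \<in> V. E w y}. x y)
                 = (if w = u then 1 else 0) - (if w = v then 1 else 0))
      in x u - x v)"

definition kirchhoff :: "'a set \<Rightarrow> ('a \<Rightarrow> 'a \<Rightarrow> bool) \<Rightarrow> real" where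
  "kirchhoff V E = (\<Sum>p\<in>{{u, v} | u v. u \<in> V \<and> v \<in> V \<and> u \<noteq> v}.
                      resistance V E (SOME u. u \<in> p) (SOME v. v \<in> p - {SOME u. u \<in> p}))"

definition adj_mat :: "nat \<Rightarrow> (nat \<Rightarrow> nat \<Rightarrow> bool) \<Rightarrow> real mat" where
  "adj_mat n E = mat n n (\<lambda>(i, j). if E i j then 1 else 0)"

definition deg_mat :: "nat \<Rightarrow> (nat \<Rightarrow> nat \<Rightarrow> bool) \<Rightarrow> real mat" where
  "deg_mat n E = mat n n (\<lambda>(i, j). if i = j then real (degree {0..<n} E i) else 0)"

definition lap_mat :: "nat \<Rightarrow> (nat \<Rightarrow> nat \<Rightarrow> bool) \<Rightarrow> real mat" where
  "lap_mat n E = deg_mat n E - adj_mat n E"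

definition deg_vec :: "nat \<Rightarrow> (nat \<Rightarrow> nat \<Rightarrow> bool) \<Rightarrow> real vec" where
  "deg_vec n E = vec n (\<lambda>i. real (degree {0..<n} E i))"

definition mat_trace :: "'a :: comm_ring_1 mat \<Rightarrow> 'a" where
  "mat_trace A = (\<Sum>i<dim_row A. A $$ (i, i))"

definition inv_mat :: "real mat \<Rightarrow> real mat" where
  "inv_mat A = the (mat_inverse A)"

(* Corona-vertex of the subdivision graph G1 \<diamond> G2.
   Vertices: (i, None)          -- vertex i of G1
             (i, Some (Inl v))  -- original vertex v of the i-th copy of S(G2)
             (i, Some (Inr e))  -- subdivision vertex of edge e in the i-th copy *)
definition corona_sub_V :: "'a set \<Rightarrow> nat \<Rightarrow> (nat \<Rightarrow> nat \<Rightarrow> bool)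
     \<Rightarrow> ('a \<times> (nat + nat set) option) set" where
  "corona_sub_V V1 n2 E2 =
     {(i, None) | i. i \<in> V1}
     \<union> {(i, Some (Inl v)) | i v. i \<in> V1 \<and> v < n2}
     \<union> {(i, Some (Inr e)) | i e. i \<in> V1 \<and> e \<in> graph_edges {0..<n2} E2}"

definition corona_sub_E :: "'a set \<Rightarrow> ('a \<Rightarrow> 'a \<Rightarrow> bool) \<Rightarrow> nat \<Rightarrow> (nat \<Rightarrow> nat \<Rightarrow> bool)
     \<Rightarrow> ('a \<times> (nat + nat set) option) \<Rightarrow> ('a \<times> (nat + nat set) option) \<Rightarrow> bool" where
  "corona_sub_E V1 E1 n2 E2 x y \<longleftrightarrow>
     (\<exists>i j. i \<in> V1 \<and> j \<in> V1 \<and> E1 i j \<and> x = (i, None) \<and> y = (j, None))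
     \<or> (\<exists>i v. i \<in> V1 \<and> v < n2 \<and>
          ((x = (i, None) \<and> y = (i, Some (Inl v))) \<or> (x = (i, Some (Inl v)) \<and> y = (i, None))))
     \<or> (\<exists>i v e. i \<in> V1 \<and> e \<in> graph_edges {0..<n2} E2 \<and> v \<in> e \<and>
          ((x = (i, Some (Inl v)) \<and> y = (i, Some (Inr e))) \<or> (x = (i, Some (Inr e)) \<and> y = (i, Some (Inl v)))))"

end

(* If g satisfies L g(., y) = delta_y - h with h independent of y, then the resistance between u and v
   is g u u - g u v - g v u + g v v, so Kf is |V| times the trace of g minus the sum of all entries
   of g.  On the corona such a g is obtained by adding, to any such kernel X of G1 (pulled back along
   the projection to V(G1)), the inverse K of the Laplacian of one copy of S(G2) grounded at its hub,
   extended by 0.  The X-part contributes (1 + n2 + m2)^2 Kf(G1); the trace and the total sum of K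
   are expressed through Q^-1. *)
theory Submission
  imports Defs "Jordan_Normal_Form.Schur_Decomposition"
begin

section \<open>Matrix inverses and traces\<close>

text \<open>The splitting works because the hub is the only link between a copy and the rest of the
  corona. A unit current injected inside a copy must leave it through the hub, so outside the copy
  it is indistinguishable from a current injected at the hub itself; and grounding at the hub makes
  the Laplacian of the copy invertible even when G2 is disconnected. The matrix Q arises by
  eliminating the subdivision vertices, which have degree 2. With R the incidence matrix of G2, R
  R^T = D + A, so the Schur complement is D + I - (D + A) / 2 = (L + 2 I) / 2 = Q / 2. This explains
  the shift by 2 in the eigenvalue sum, and it is why D and A reappear separately next to the
  inverse of Q in the trace.\<close>

lemma mult_mat_entry:
  assumes "A \<in> carrier_mat n m" "B \<in> carrier_mat m k" "i < n" "j < k"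
  shows "(A * B) $$ (i, j) = (\<Sum>l<m. A $$ (i, l) * B $$ (l, j))"
  using assms by (auto simp: scalar_prod_def atLeast0LessThan intro!: sum.cong)

lemma mat_trace_comm:
  fixes A :: "'a :: comm_ring_1 mat"
  assumes "A \<in> carrier_mat n m" "B \<in> carrier_mat m n"
  shows "mat_trace (A * B) = mat_trace (B * A)"
proof -
  have "mat_trace (A * B) = (\<Sum>i<n. \<Sum>j<m. A $$ (i, j) * B $$ (j, i))"
    using assms mult_mat_entry[OF assms] unfolding mat_trace_def by auto
  also have "\<dots> = (\<Sum>j<m. \<Sum>i<n. B $$ (j, i) * A $$ (i, j))"
    by (subst sum.swap) (simp add: mult.commute)
  also have "\<dots> = mat_trace (B * A)"
    using assms mult_mat_entry[OF assms(2,1)] unfolding mat_trace_def by auto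
  finally show ?thesis .
qed

lemma inv_mat:
  assumes A: "A \<in> carrier_mat n n" and "det A \<noteq> 0"
  shows "inv_mat A \<in> carrier_mat n n" "A * inv_mat A = 1\<^sub>m n" "inv_mat A * A = 1\<^sub>m n"
proof -
  have "mat_inverse A \<noteq> None"
    using mat_inverse(1)[OF A, of "()"] det_non_zero_imp_unit[OF assms, of "()"] by blast
  then have "mat_inverse A = Some (inv_mat A)"
    by (simp add: inv_mat_def)
  from mat_inverse(2)[OF A this]
  show "inv_mat A \<in> carrier_mat n n" "A * inv_mat A = 1\<^sub>m n" "inv_mat A * A = 1\<^sub>m n"
    by blast+
qed

text \<open>Forward substitution along row \<open>i\<close> of \<open>W * U\<close>: the entries of
  \<open>W\<close> left of the diagonal vanish one after another, and the diagonal position then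
  reads \<open>W $$ (i, i) * U $$ (i, i) = 1\<close>.\<close>

lemma inverse_upper_triangular_diag:
  fixes U W :: "'a :: field mat"
  assumes U: "U \<in> carrier_mat n n" "upper_triangular U" and W: "W \<in> carrier_mat n n"
    and WU: "W * U = 1\<^sub>m n" and i: "i < n"
  shows "W $$ (i, i) = 1 / U $$ (i, i)"
proof -
  have "det W * det U = 1"
    using det_mult[OF W U(1)] WU by simp
  then have "prod_list (diag_mat U) \<noteq> 0"
    using det_upper_triangular[OF U(2,1)] by (metis mult_zero_right zero_neq_one)
  then have nz: "U $$ (j, j) \<noteq> 0" if "j < n" for j
    using that U(1) by (auto simp: diag_mat_def prod_list_zero_iff)
  \<comment> \<open>Only the term \<open>k = j\<close> of the product survives: smaller
    \<open>k\<close> vanish by assumption, larger \<open>k\<close> because \<open>U\<close> is upper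
    triangular.\<close>
  have entry: "(if i = j then 1 else 0) = W $$ (i, j) * U $$ (j, j)"
    if "j \<le> i" "\<forall>k<j. W $$ (i, k) = 0" for j
  proof -
    have "(if i = j then 1 else 0) = (\<Sum>k<n. W $$ (i, k) * U $$ (k, j))"
      using mult_mat_entry[OF W U(1) i, of j] that i WU by auto
    also have "\<dots> = (\<Sum>k<n. if k = j then W $$ (i, k) * U $$ (k, j) else 0)"
    proof (rule sum.cong)
      fix k assume "k \<in> {..<n}"
      then show "W $$ (i, k) * U $$ (k, j) = (if k = j then W $$ (i, k) * U $$ (k, j) else 0)"
        using that(2) U upper_triangularD[OF U(2), of j k] by (cases k j rule: linorder_cases) auto
    qed simp
    also have "\<dots> = W $$ (i, j) * U $$ (j, j)"
      using that i by (simp add: sum.delta)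
    finally show ?thesis .
  qed
  have "j < i \<Longrightarrow> W $$ (i, j) = 0" for j
  proof (induction j rule: less_induct)
    case (less j)
    then show ?case using entry[of j] nz[of j] i by auto
  qed
  then show ?thesis using entry[of i] nz[OF i] by (auto simp: field_simps)
qed

text \<open>Schur triangularization puts the list \<open>\<mu>\<close> on the diagonal of a
  triangular \<open>B\<close> similar to \<open>A\<close>. Conjugating the inverse of A + c I
  accordingly keeps its trace and yields the inverse of the triangular matrix B + c I, whose
  diagonal is known.\<close>

lemma mat_trace_inv_shift:
  fixes A :: "real mat"
  assumes A: "A \<in> carrier_mat n n"
    and cp: "char_poly A = (\<Prod>a\<leftarrow>\<mu>. [:- a, 1:])"
    and det: "det (A + c \<cdot>\<^sub>m 1\<^sub>m n) \<noteq> 0"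
  shows "mat_trace (inv_mat (A + c \<cdot>\<^sub>m 1\<^sub>m n)) = (\<Sum>a\<leftarrow>\<mu>. 1 / (a + c))"
proof -
  obtain B P R where "schur_decomposition A \<mu> = (B, P, R)"
    by (metis prod_cases3)
  from schur_decomposition[OF A cp this]
  have sim: "similar_mat_wit A B P R" and B: "upper_triangular B" "diag_mat B = \<mu>"
    by auto
  note s = similar_mat_witD2[OF A sim]
  define M where "M = A + c \<cdot>\<^sub>m 1\<^sub>m n"
  define U where "U = B + c \<cdot>\<^sub>m 1\<^sub>m n"
  have M: "M \<in> carrier_mat n n" and U: "U \<in> carrier_mat n n"
    using A s(5) by (auto simp: M_def U_def)
  note N = inv_mat[OF M det[folded M_def]]
  define W where "W = R * (inv_mat M * P)"
  have W: "W \<in> carrier_mat n n"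
    unfolding W_def by (intro mult_carrier_mat[OF s(7)] mult_carrier_mat[OF N(1) s(6)])
  have PU: "P * U = M * P"
  proof -
    have PB: "P * B \<in> carrier_mat n n"
      using s(6,5) by (rule mult_carrier_mat)
    have "M * P = P * B * R * P + c \<cdot>\<^sub>m 1\<^sub>m n * P"
      unfolding M_def s(3)[symmetric] by (rule add_mult_distrib_mat[OF A _ s(6)]) simp
    also have "P * B * R * P = P * B * (R * P)"
      by (rule assoc_mult_mat[OF PB s(7,6)])
    also have "\<dots> = P * B"
      unfolding s(2) by (rule right_mult_one_mat[OF PB])
    also have "c \<cdot>\<^sub>m 1\<^sub>m n * P = P * (c \<cdot>\<^sub>m 1\<^sub>m n)"
      using mult_smult_assoc_mat[OF one_carrier_mat s(6), of c] mult_smult_distrib[OF s(6) one_carrier_mat, of c]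
        left_mult_one_mat[OF s(6)] right_mult_one_mat[OF s(6)] by simp
    also have "P * B + P * (c \<cdot>\<^sub>m 1\<^sub>m n) = P * U"
      unfolding U_def by (rule mult_add_distrib_mat[OF s(6,5), symmetric]) simp
    finally show ?thesis by (rule sym)
  qed
  have NP: "inv_mat M * P \<in> carrier_mat n n"
    using N(1) s(6) by (rule mult_carrier_mat)
  have "W * U = R * (inv_mat M * P * U)"
    unfolding W_def by (rule assoc_mult_mat[OF s(7) NP U])
  also have "inv_mat M * P * U = inv_mat M * (M * P)"
    unfolding PU[symmetric] by (rule assoc_mult_mat[OF N(1) s(6) U])
  also have "\<dots> = inv_mat M * M * P"
    by (rule assoc_mult_mat[OF N(1) M s(6), symmetric])
  also have "\<dots> = P"
    unfolding N(3) by (rule left_mult_one_mat[OF s(6)])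
  finally have WU: "W * U = 1\<^sub>m n" unfolding s(2) .
  have Utri: "upper_triangular U"
    using B(1) s(5) by (auto simp: U_def upper_triangular_def)
  have "mat_trace W = mat_trace (inv_mat M * P * R)"
    unfolding W_def by (rule mat_trace_comm[OF s(7) NP])
  also have "inv_mat M * P * R = inv_mat M * (P * R)"
    by (rule assoc_mult_mat[OF N(1) s(6,7)])
  also have "\<dots> = inv_mat M"
    unfolding s(1) by (rule right_mult_one_mat[OF N(1)])
  finally have "mat_trace (inv_mat M) = mat_trace W" by (rule sym)
  also have "\<dots> = (\<Sum>i<n. 1 / U $$ (i, i))"
    using W inverse_upper_triangular_diag[OF U Utri W WU] by (simp add: mat_trace_def)
  also have "\<dots> = (\<Sum>i<n. 1 / (B $$ (i, i) + c))"
    using s(5) by (intro sum.cong) (auto simp: U_def)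
  also have "\<dots> = (\<Sum>a\<leftarrow>diag_mat B. 1 / (a + c))"
    using s(5) by (simp add: diag_mat_def interv_sum_list_conv_sum_set_nat atLeast0LessThan o_def)
  finally show ?thesis by (simp add: B(2) M_def)
qed

lemma det_nonzero_if_inj:
  fixes A :: "'a :: idom mat"
  assumes A: "A \<in> carrier_mat n n"
    and inj: "\<And>x. (\<And>i. i < n \<Longrightarrow> (\<Sum>j<n. A $$ (i, j) * x j) = 0) \<Longrightarrow> (\<And>i. i < n \<Longrightarrow> x i = 0)"
  shows "det A \<noteq> 0"
proof
  assume "det A = 0"
  then obtain v where v: "v \<in> carrier_vec n" "v \<noteq> 0\<^sub>v n" "A *\<^sub>v v = 0\<^sub>v n"
    using det_0_iff_vec_prod_zero[OF A] by blast
  have "v $ i = 0" if "i < n" for i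
  proof (rule inj[of "\<lambda>i. v $ i"])
    fix i assume "i < n"
    moreover from this have "(A *\<^sub>v v) $ i = (\<Sum>j<n. A $$ (i, j) * v $ j)"
      using A v(1) by (auto simp: scalar_prod_def atLeast0LessThan intro!: sum.cong)
    ultimately show "(\<Sum>j<n. A $$ (i, j) * v $ j) = 0"
      using v(3) by simp
  qed (fact that)
  with v show False by auto
qed

text \<open>Carries matrix inversion over to kernels on an arbitrary finite set by enumerating
  \<open>V\<close>; the vertices of G1 form such a set.\<close>

lemma right_inverse_of_inj:
  fixes M :: "'a \<Rightarrow> 'a \<Rightarrow> real"
  assumes fin: "finite V"
    and inj: "\<And>x. (\<And>i. i \<in> V \<Longrightarrow> (\<Sum>j\<in>V. M i j * x j) = 0) \<Longrightarrow> (\<And>i. i \<in> V \<Longrightarrow> x i = 0)"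
  obtains X where "\<And>i k. i \<in> V \<Longrightarrow> k \<in> V \<Longrightarrow> (\<Sum>j\<in>V. M i j * X j k) = (if i = k then 1 else 0)"
proof -
  let ?n = "card V"
  obtain f where f: "bij_betw f V {..<?n}"
    using ex_bij_betw_finite_nat[OF fin] by (auto simp: atLeast0LessThan)
  define g where "g = inv_into V f"
  have g: "bij_betw g {..<?n} V" and gf: "\<And>v. v \<in> V \<Longrightarrow> g (f v) = v"
    and fg: "\<And>i. i < ?n \<Longrightarrow> f (g i) = i"
    using f by (auto simp: g_def bij_betw_inv_into bij_betw_inv_into_left bij_betw_inv_into_right)
  have fV: "f v < ?n" if "v \<in> V" for v using f that by (auto simp: bij_betw_def)
  have gV: "g i \<in> V" if "i < ?n" for i using g that by (auto simp: bij_betw_def)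
  define A where "A = mat ?n ?n (\<lambda>(i, j). M (g i) (g j))"
  have A: "A \<in> carrier_mat ?n ?n" by (simp add: A_def)
  have "det A \<noteq> 0"
  proof (rule det_nonzero_if_inj[OF A])
    fix x i assume x: "\<And>i. i < ?n \<Longrightarrow> (\<Sum>j<?n. A $$ (i, j) * x j) = 0" and i: "i < ?n"
    have "x (f (g i)) = 0"
    proof (rule inj[of "\<lambda>v. x (f v)"])
      fix u assume u: "u \<in> V"
      have "(\<Sum>v\<in>V. M u v * x (f v)) = (\<Sum>j<?n. M u (g j) * x (f (g j)))"
        by (rule sum.reindex_bij_betw[OF g, symmetric])
      also have "\<dots> = (\<Sum>j<?n. A $$ (f u, j) * x j)"
        using u fV gf fg by (intro sum.cong) (auto simp: A_def)
      finally show "(\<Sum>v\<in>V. M u v * x (f v)) = 0" using x fV[OF u] by simp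
    qed (use gV i in simp)
    then show "x i = 0" using fg i by simp
  qed
  note N = inv_mat[OF A this]
  show thesis
  proof
    fix i k assume ik: "i \<in> V" "k \<in> V"
    have "(\<Sum>j\<in>V. M i j * inv_mat A $$ (f j, f k)) = (\<Sum>j<?n. M i (g j) * inv_mat A $$ (f (g j), f k))"
      by (rule sum.reindex_bij_betw[OF g, symmetric])
    also have "\<dots> = (\<Sum>j<?n. A $$ (f i, j) * inv_mat A $$ (j, f k))"
      using ik fV gf fg by (intro sum.cong) (auto simp: A_def)
    also have "\<dots> = (A * inv_mat A) $$ (f i, f k)"
      using mult_mat_entry[OF A N(1)] fV ik by simp
    also have "\<dots> = (if i = k then 1 else 0)"
      using N(2) fV gf ik by auto metis
    finally show "(\<Sum>j\<in>V. M i j * inv_mat A $$ (f j, f k)) = (if i = k then 1 else 0)" .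
  qed
qed

section \<open>Green kernels and the Kirchhoff index\<close>

lemma simple_graphD:
  assumes "simple_graph V E"
  shows "finite V" "E u v \<Longrightarrow> u \<in> V" "E u v \<Longrightarrow> v \<in> V" "E u v \<Longrightarrow> E v u" "\<not> E u u"
  using assms by (auto simp: simple_graph_def)

section \<open>Edge sums and double counting of incidences\<close>

lemma finite_graph_edges:
  assumes "simple_graph V E"
  shows "finite (graph_edges V E)"
proof (rule finite_subset)
  show "graph_edges V E \<subseteq> Pow V" by (auto simp: graph_edges_def)
qed (use simple_graphD(1)[OF assms] in simp)

lemma sum_graph_edge:
  assumes "simple_graph V E" "E u v"
  shows "(\<Sum>w\<in>{u, v}. f w) = f u + (f v :: 'b :: comm_monoid_add)"
  using simple_graphD(5)[OF assms(1)] assms(2) by (subst sum.insert) auto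

lemma sum_incident_edges:
  assumes G: "simple_graph V E" and u: "u \<in> V"
  shows "(\<Sum>e\<in>{e \<in> graph_edges V E. u \<in> e}. F e) = (\<Sum>w\<in>{w \<in> V. E u w}. F {u, w})"
proof -
  have "bij_betw (\<lambda>w. {u, w}) {w \<in> V. E u w} {e \<in> graph_edges V E. u \<in> e}"
    unfolding bij_betw_def
  proof
    show "inj_on (\<lambda>w. {u, w}) {w \<in> V. E u w}"
      by (auto simp: inj_on_def doubleton_eq_iff)
    show "(\<lambda>w. {u, w}) ` {w \<in> V. E u w} = {e \<in> graph_edges V E. u \<in> e}"
      using u simple_graphD(4)[OF G] by (auto simp: graph_edges_def insert_commute image_iff)
  qed
  from sum.reindex_bij_betw[OF this, of F] show ?thesis by simp
qed

lemma sum_edges_endpoints: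
  assumes G: "simple_graph V E"
  shows "(\<Sum>e\<in>graph_edges V E. \<Sum>u\<in>e. h u e) = (\<Sum>u\<in>V. \<Sum>w\<in>{w \<in> V. E u w}. h u {u, w})"
proof -
  have "(\<Sum>e\<in>graph_edges V E. \<Sum>u\<in>e. h u e) = (\<Sum>e\<in>graph_edges V E. \<Sum>u\<in>{u \<in> V. u \<in> e}. h u e)"
    by (intro sum.cong) (auto simp: graph_edges_def)
  also have "\<dots> = (\<Sum>u\<in>V. \<Sum>e\<in>{e \<in> graph_edges V E. u \<in> e}. h u e)"
    by (rule sum.swap_restrict) (use finite_graph_edges[OF G] simple_graphD(1)[OF G] in auto)
  also have "\<dots> = (\<Sum>u\<in>V. \<Sum>w\<in>{w \<in> V. E u w}. h u {u, w})"
    by (intro sum.cong sum_incident_edges[OF G]) auto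
  finally show ?thesis .
qed

section \<open>The Laplacian as an operator and its Dirichlet form\<close>

definition lap :: "'a set \<Rightarrow> ('a \<Rightarrow> 'a \<Rightarrow> bool) \<Rightarrow> ('a \<Rightarrow> real) \<Rightarrow> 'a \<Rightarrow> real" where
  "lap V E x w = (\<Sum>y\<in>{y \<in> V. E w y}. x w - x y)"

lemma lap_altdef: "lap V E x w = real (degree V E w) * x w - (\<Sum>y\<in>{y \<in> V. E w y}. x y)"
  by (simp add: lap_def degree_def sum_subtractf)

lemma lap_diff: "lap V E (\<lambda>w. x w - z w) w = lap V E x w - lap V E z w"
  by (simp add: lap_def sum_subtractf algebra_simps)

text \<open>Summation by parts: exchanging the two ends of every ordered edge gives the left side a
  second time, and the two versions add up to the Dirichlet form. Its symmetry, its vanishing on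
  constants and its nonnegativity give the lemmas that follow.\<close>

lemma sum_mult_lap:
  assumes G: "simple_graph V E"
  shows "(\<Sum>w\<in>V. x w * lap V E z w) =
    1/2 * (\<Sum>w\<in>V. \<Sum>y\<in>{y \<in> V. E w y}. (x w - x y) * (z w - z y))"
proof -
  note fin = simple_graphD(1)[OF G]
  have "(\<Sum>w\<in>V. x w * lap V E z w) = (\<Sum>w\<in>V. \<Sum>y\<in>{y \<in> V. E w y}. x w * (z w - z y))"
    by (simp add: lap_def sum_distrib_left)
  moreover have "\<dots> = (\<Sum>y\<in>V. \<Sum>w\<in>{w \<in> V. E w y}. x w * (z w - z y))"
    by (rule sum.swap_restrict[OF fin fin])
  moreover have "\<dots> = (\<Sum>y\<in>V. \<Sum>w\<in>{w \<in> V. E y w}. x w * (z w - z y))"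
    using simple_graphD(4)[OF G] by (intro sum.cong) auto
  moreover have "(\<Sum>w\<in>V. \<Sum>y\<in>{y \<in> V. E w y}. (x w - x y) * (z w - z y)) =
      (\<Sum>w\<in>V. \<Sum>y\<in>{y \<in> V. E w y}. x w * (z w - z y)) +
      (\<Sum>y\<in>V. \<Sum>w\<in>{w \<in> V. E y w}. x w * (z w - z y))"
    unfolding sum.distrib[symmetric] by (intro sum.cong) (auto simp: algebra_simps)
  ultimately show ?thesis by simp
qed

lemma lap_self_adjoint:
  assumes "simple_graph V E"
  shows "(\<Sum>w\<in>V. x w * lap V E z w) = (\<Sum>w\<in>V. z w * lap V E x w)"
  by (simp add: sum_mult_lap[OF assms] mult.commute)

lemma sum_lap:
  assumes "simple_graph V E"
  shows "(\<Sum>w\<in>V. lap V E z w) = 0"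
  using sum_mult_lap[OF assms, of "\<lambda>_. 1" z] by simp

lemma sum_mult_lap_nonneg:
  assumes "simple_graph V E"
  shows "(\<Sum>w\<in>V. x w * lap V E x w) \<ge> 0"
proof -
  have "(\<Sum>w\<in>V. \<Sum>y\<in>{y \<in> V. E w y}. (x w - x y) * (x w - x y)) \<ge> 0"
    by (intro sum_nonneg zero_le_square)
  then show ?thesis by (simp add: sum_mult_lap[OF assms])
qed

lemma sum_mult_lap_eq_0D:
  assumes G: "simple_graph V E" and 0: "(\<Sum>w\<in>V. x w * lap V E x w) = 0" and E: "E u v"
  shows "x u = x v"
proof -
  note fin = simple_graphD(1)[OF G]
  let ?f = "\<lambda>w. \<Sum>y\<in>{y \<in> V. E w y}. (x w - x y) * (x w - x y)"
  have "(\<Sum>w\<in>V. ?f w) = 0" using 0 unfolding sum_mult_lap[OF G] by simp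
  then have "\<forall>w\<in>V. ?f w = 0"
    by (subst (asm) sum_nonneg_eq_0_iff) (auto intro: fin sum_nonneg)
  then have "?f u = 0" using simple_graphD(2)[OF G E] by blast
  then have "\<forall>y\<in>{y \<in> V. E u y}. (x u - x y) * (x u - x y) = 0"
    by (subst (asm) sum_nonneg_eq_0_iff) (use fin in auto)
  then show ?thesis using E simple_graphD(3)[OF G E] by auto
qed

text \<open>Self-adjointness determines the potential difference without any connectivity:
  if \<open>x\<close> and \<open>z\<close> both solve the system, then
  \<open>x u - x v = \<langle>x, L z\<rangle> = \<langle>L x, z\<rangle> = z u - z v\<close>.\<close>

lemma resistance_eq:
  assumes G: "simple_graph V E" and uv: "u \<in> V" "v \<in> V"
    and z: "\<And>w. w \<in> V \<Longrightarrow> lap V E z w = (if w = u then 1 else 0) - (if w = v then 1 else 0)"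
  shows "resistance V E u v = z u - z v"
proof -
  define P where "P x \<longleftrightarrow> (\<forall>w\<in>V. lap V E x w = (if w = u then 1 else 0) - (if w = v then 1 else 0))"
    for x
  define x where "x = (SOME x. P x)"
  have "P x" unfolding x_def by (rule someI[of P z]) (use z in \<open>simp add: P_def\<close>)
  have pair: "(\<Sum>w\<in>V. f w * lap V E g w) = f u - f v" if "P g" for f g
  proof -
    have "(\<Sum>w\<in>V. f w * lap V E g w) =
        (\<Sum>w\<in>V. (if w = u then f w else 0) - (if w = v then f w else 0))"
      using that by (intro sum.cong) (auto simp: P_def)
    then show ?thesis using uv simple_graphD(1)[OF G] by (simp add: sum_subtractf sum.delta)
  qed
  have "resistance V E u v = x u - x v"
    by (simp add: resistance_def x_def P_def lap_altdef Let_def)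
  also have "\<dots> = z u - z v"
    using pair[of z x] pair[of x z] lap_self_adjoint[OF G, of x z] \<open>P x\<close> z by (simp add: P_def)
  finally show ?thesis .
qed

text \<open>Every image of the Laplacian sums to 0, so a bare delta is not attainable and some
  \<open>h\<close> of total 1 must be subtracted. Leaving \<open>h\<close> free lets it be constant
  in \<open>green_exists\<close> and supported on the hubs in \<open>green_corona\<close>.\<close>

definition green :: "'a set \<Rightarrow> ('a \<Rightarrow> 'a \<Rightarrow> bool) \<Rightarrow> ('a \<Rightarrow> 'a \<Rightarrow> real) \<Rightarrow> bool" where
  "green V E g \<longleftrightarrow> (\<exists>h. \<forall>w\<in>V. \<forall>y\<in>V. lap V E (\<lambda>v. g v y) w = (if w = y then 1 else 0) - h w)"

lemma kirchhoff_green: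
  assumes G: "simple_graph V E" and g: "green V E g"
  shows "kirchhoff V E = real (card V) * (\<Sum>v\<in>V. g v v) - (\<Sum>u\<in>V. \<Sum>v\<in>V. g u v)"
proof -
  note fin = simple_graphD(1)[OF G]
  from g obtain h where h: "\<And>w y. w \<in> V \<Longrightarrow> y \<in> V \<Longrightarrow>
      lap V E (\<lambda>v. g v y) w = (if w = y then 1 else 0) - h w"
    unfolding green_def by blast
  define r where "r u v = g u u - g u v - g v u + g v v" for u v
  have res: "resistance V E u v = r u v" if "u \<in> V" "v \<in> V" for u v
  proof -
    \<comment> \<open>Subtracting columns \<open>u\<close> and \<open>v\<close> of \<open>g\<close>
      cancels \<open>h\<close> and leaves the unit dipole.\<close>
    have "resistance V E u v = (g u u - g u v) - (g v u - g v v)"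
      by (rule resistance_eq[OF G that, of "\<lambda>w. g w u - g w v"]) (use that in \<open>simp add: lap_diff h\<close>)
    then show ?thesis by (simp add: r_def)
  qed
  \<comment> \<open>The complete graph on \<open>V\<close>: its edges are the unordered pairs of the
    Kirchhoff index, so the double counting lemma applies to them.\<close>
  define K where "K u v \<longleftrightarrow> u \<in> V \<and> v \<in> V \<and> u \<noteq> v" for u v
  have KG: "simple_graph V K" using fin by (auto simp: simple_graph_def K_def)
  define R where "R p = resistance V E (SOME u. u \<in> p) (SOME v. v \<in> p - {SOME u. u \<in> p})" for p
  \<comment> \<open>The choice operators may list the pair in either order; this is harmless because
    \<open>r\<close> is symmetric.\<close>
  have R: "R {u, v} = r u v" if "u \<in> V" "v \<in> V" "u \<noteq> v" for u v
  proof -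
    define a where "a = (SOME u'. u' \<in> {u, v})"
    define b where "b = (SOME v'. v' \<in> {u, v} - {a})"
    have a: "a \<in> {u, v}" unfolding a_def by (rule someI[of _ u]) simp
    then have "\<exists>v'. v' \<in> {u, v} - {a}" using that(3) by auto
    then have "b \<in> {u, v} - {a}" unfolding b_def by (rule someI_ex)
    with a have "a = u \<and> b = v \<or> a = v \<and> b = u" by auto
    moreover have "R {u, v} = resistance V E a b" by (simp add: R_def a_def b_def)
    ultimately show ?thesis using res that by (auto simp: r_def)
  qed
  have edges: "graph_edges V K = {{u, v} | u v. u \<in> V \<and> v \<in> V \<and> u \<noteq> v}"
    by (auto simp: graph_edges_def K_def)
  have "2 * kirchhoff V E = (\<Sum>p\<in>graph_edges V K. 2 * R p)"
    by (simp add: kirchhoff_def edges R_def sum_distrib_left)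
  also have "\<dots> = (\<Sum>p\<in>graph_edges V K. \<Sum>u\<in>p. R p)"
    by (intro sum.cong) (auto simp: graph_edges_def K_def)
  also have "\<dots> = (\<Sum>u\<in>V. \<Sum>v\<in>{v \<in> V. K u v}. R {u, v})"
    by (rule sum_edges_endpoints[OF KG])
  also have "\<dots> = (\<Sum>u\<in>V. \<Sum>v\<in>V. r u v)"
  proof (rule sum.cong[OF refl])
    fix u assume u: "u \<in> V"
    have "(\<Sum>v\<in>{v \<in> V. K u v}. R {u, v}) = (\<Sum>v\<in>{v \<in> V. K u v}. r u v)"
      using R by (intro sum.cong) (auto simp: K_def)
    \<comment> \<open>Diagonal terms can be added because \<open>r u u = 0\<close>.\<close>
    also have "\<dots> = (\<Sum>v\<in>V. r u v)"
      using u by (intro sum.mono_neutral_left fin) (auto simp: K_def r_def)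
    finally show "(\<Sum>v\<in>{v \<in> V. K u v}. R {u, v}) = (\<Sum>v\<in>V. r u v)" .
  qed
  also have "\<dots> = 2 * (real (card V) * (\<Sum>v\<in>V. g v v) - (\<Sum>u\<in>V. \<Sum>v\<in>V. g u v))"
    using sum.swap[of "\<lambda>u v. g v u" V V]
    by (simp add: r_def sum.distrib sum_subtractf sum_distrib_left algebra_simps)
  finally show ?thesis by simp
qed

text \<open>L is singular, but L + J with J the all-ones matrix is injective: summing (L + J) x = 0
  over \<open>V\<close> forces the sum of \<open>x\<close> to vanish, then L x = 0, so connectivity
  makes \<open>x\<close> constant and hence 0. A right inverse of L + J is the kernel.\<close>

lemma green_exists:
  assumes "connected_graph V E"
  obtains g where "green V E g"
proof -
  have G: "simple_graph V E" and ne: "V \<noteq> {}" and conn: "\<And>u v. u \<in> V \<Longrightarrow> v \<in> V \<Longrightarrow> E\<^sup>*\<^sup>* u v"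
    using assms by (auto simp: connected_graph_def)
  note fin = simple_graphD(1)[OF G]
  let ?n = "real (card V)"
  have n: "?n > 0" using fin ne by (simp add: card_gt_0_iff)
  define M where "M i j = (if i = j then real (degree V E i) else 0) - (if E i j then 1 else 0) + 1"
    for i j
  have M: "(\<Sum>j\<in>V. M i j * x j) = lap V E x i + (\<Sum>j\<in>V. x j)" if "i \<in> V" for i x
  proof -
    have "(\<Sum>j\<in>V. M i j * x j) = (\<Sum>j\<in>V. (if i = j then real (degree V E i) * x j else 0)
        - (if E i j then x j else 0) + x j)"
      by (intro sum.cong) (auto simp: M_def algebra_simps)
    also have "\<dots> = lap V E x i + (\<Sum>j\<in>V. x j)"
      using that fin by (simp add: lap_altdef sum.distrib sum_subtractf sum.delta' sum.inter_filter)
    finally show ?thesis .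
  qed
  obtain X where X: "\<And>i k. i \<in> V \<Longrightarrow> k \<in> V \<Longrightarrow> (\<Sum>j\<in>V. M i j * X j k) = (if i = k then 1 else 0)"
  proof (rule right_inverse_of_inj[OF fin, of M])
    fix x i assume Mx: "\<And>i. i \<in> V \<Longrightarrow> (\<Sum>j\<in>V. M i j * x j) = 0" and i: "i \<in> V"
    let ?s = "\<Sum>j\<in>V. x j"
    have lapx: "lap V E x w = - ?s" if "w \<in> V" for w using Mx M that by fastforce
    then have "- ?n * ?s = 0" using sum_lap[OF G, of x] by simp
    then have s: "?s = 0" using n by simp
    have "(\<Sum>w\<in>V. x w * lap V E x w) = 0" using lapx s by simp
    then have edge: "x u = x v" if "E u v" for u v using sum_mult_lap_eq_0D[OF G _ that] by blast
    have "x u = x i" if "u \<in> V" for u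
      using conn[OF i that] by (induction rule: rtranclp_induct) (auto dest: edge)
    then have "?s = ?n * x i" by simp
    then show "x i = 0" using s n by simp
  qed blast
  have "green V E X" unfolding green_def
  proof (intro exI ballI)
    fix w y assume wy: "w \<in> V" "y \<in> V"
    let ?s = "\<Sum>j\<in>V. X j y"
    have eq: "lap V E (\<lambda>v. X v y) i + ?s = (if i = y then 1 else 0)" if "i \<in> V" for i
      using M[OF that, of "\<lambda>v. X v y"] X[OF that wy(2)] by simp
    \<comment> \<open>The Laplacian part sums to 0, so every column of \<open>X\<close> has sum 1 /
      n; this is the constant correction.\<close>
    have "(\<Sum>i\<in>V. lap V E (\<lambda>v. X v y) i + ?s) = 1"
      using eq wy fin by (simp add: sum.delta)
    then have "?n * ?s = 1" by (simp add: sum.distrib sum_lap[OF G])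
    then have "?s = 1 / ?n" using n by (simp add: field_simps)
    with eq[OF wy(1)] show "lap V E (\<lambda>v. X v y) w = (if w = y then 1 else 0) - 1 / ?n" by simp
  qed
  then show thesis by (rule that)
qed

section \<open>The corona-vertex of the subdivision graph\<close>

abbreviation hub :: "'a \<Rightarrow> 'a \<times> (nat + nat set) option" where
  "hub i \<equiv> (i, None)"

abbreviation orig :: "'a \<Rightarrow> nat \<Rightarrow> 'a \<times> (nat + nat set) option" where
  "orig i v \<equiv> (i, Some (Inl v))"

abbreviation subd :: "'a \<Rightarrow> nat set \<Rightarrow> 'a \<times> (nat + nat set) option" where
  "subd i e \<equiv> (i, Some (Inr e))"

locale corona_sub =
  fixes V1 :: "'a set" and E1 :: "'a \<Rightarrow> 'a \<Rightarrow> bool"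
    and n :: nat and E2 :: "nat \<Rightarrow> nat \<Rightarrow> bool"
  assumes G1: "simple_graph V1 E1" and G2: "simple_graph {0..<n} E2"
begin

abbreviation "EE \<equiv> graph_edges {0..<n} E2"
abbreviation "CV \<equiv> corona_sub_V V1 n E2"
abbreviation "CE \<equiv> corona_sub_E V1 E1 n E2"
abbreviation "deg u \<equiv> real (degree {0..<n} E2 u)"

section \<open>The matrix Q of G2 and its inverse\<close>

definition QG :: "real mat" where
  "QG = lap_mat n E2 + 2 \<cdot>\<^sub>m 1\<^sub>m n"

definition q :: "nat \<Rightarrow> nat \<Rightarrow> real" where
  "q u v = inv_mat QG $$ (u, v)"

lemma finEE: "finite EE"
  by (rule finite_graph_edges[OF G2])

lemma edgeE:
  assumes "e \<in> EE"
  obtains u v where "e = {u, v}" "u < n" "v < n" "E2 u v" "u \<noteq> v"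
proof -
  from assms obtain u v where "e = {u, v}" "u < n" "v < n" "E2 u v"
    by (auto simp: graph_edges_def)
  then show thesis using that simple_graphD(5)[OF G2] by metis
qed

lemma edge_less: "e \<in> EE \<Longrightarrow> u \<in> e \<Longrightarrow> u < n"
  by (auto simp: graph_edges_def)

lemma card_edge: "e \<in> EE \<Longrightarrow> card e = 2"
  by (erule edgeE) simp

lemma card_incident: "u < n \<Longrightarrow> real (card {e \<in> EE. u \<in> e}) = deg u"
  using sum_incident_edges[OF G2, of u "\<lambda>_. 1::real"] by (simp add: degree_def)

lemma sum_edges_ends:
  "(\<Sum>e\<in>EE. \<Sum>u\<in>e. f u) = (\<Sum>u<n. deg u * f u)"
  by (simp add: sum_edges_endpoints[OF G2] degree_def lessThan_atLeast0)

lemma sum_deg: "(\<Sum>u<n. deg u) = 2 * real (card EE)"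
  using sum_edges_ends[of "\<lambda>_. 1"] by (simp add: card_edge)

lemma Q_carrier: "QG \<in> carrier_mat n n"
  by (simp add: QG_def lap_mat_def deg_mat_def adj_mat_def)

lemma Q_entry:
  assumes "i < n" "j < n"
  shows "QG $$ (i, j) = (if i = j then deg i + 2 else 0) - (if E2 i j then 1 else 0)"
  using assms by (auto simp: QG_def lap_mat_def deg_mat_def adj_mat_def)

lemma Q_sym: "i < n \<Longrightarrow> j < n \<Longrightarrow> QG $$ (i, j) = QG $$ (j, i)"
  using simple_graphD(4)[OF G2] by (auto simp: Q_entry)

lemma sum_nbrs:
  fixes f :: "nat \<Rightarrow> real"
  shows "(\<Sum>w\<in>{w \<in> {0..<n}. E2 u w}. f w) = (\<Sum>w<n. if E2 u w then f w else 0)"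
  by (simp only: lessThan_atLeast0 sum.inter_filter[OF finite_atLeastLessThan])

lemma Q_apply:
  assumes "i < n"
  shows "(\<Sum>j<n. QG $$ (i, j) * x j) = lap {0..<n} E2 x i + 2 * x i"
proof -
  have "(\<Sum>j<n. QG $$ (i, j) * x j) = (\<Sum>j<n. (if i = j then (deg i + 2) * x j else 0)
      - (if E2 i j then x j else 0))"
    using assms by (intro sum.cong) (auto simp: Q_entry algebra_simps)
  also have "\<dots> = lap {0..<n} E2 x i + 2 * x i"
    using assms unfolding lap_altdef sum_nbrs
    by (simp add: sum_subtractf sum.delta' algebra_simps)
  finally show ?thesis .
qed

text \<open>Q is positive definite: a kernel vector satisfies L x = -2 x, and nonnegativity of the
  Dirichlet form then forces its squared norm to be at most 0.\<close>

lemma det_Q: "det QG \<noteq> 0"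
proof (rule det_nonzero_if_inj[OF Q_carrier])
  fix x :: "nat \<Rightarrow> real" and i
  assume x: "\<And>i. i < n \<Longrightarrow> (\<Sum>j<n. QG $$ (i, j) * x j) = 0" and i: "i < n"
  have "lap {0..<n} E2 x w = - 2 * x w" if "w < n" for w
    using x Q_apply that by fastforce
  then have "(\<Sum>w\<in>{0..<n}. x w * lap {0..<n} E2 x w) = - 2 * (\<Sum>w\<in>{0..<n}. x w * x w)"
    by (simp add: sum_distrib_left algebra_simps)
  with sum_mult_lap_nonneg[OF G2, of x] have "(\<Sum>w\<in>{0..<n}. x w * x w) \<le> 0" by simp
  moreover have "(\<Sum>w\<in>{0..<n}. x w * x w) \<ge> 0" by (intro sum_nonneg) simp
  ultimately have "(\<Sum>w\<in>{0..<n}. x w * x w) = 0" by simp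
  then have "\<forall>w\<in>{0..<n}. x w * x w = 0" by (subst (asm) sum_nonneg_eq_0_iff) auto
  then show "x i = 0" using i by simp
qed

lemmas inv_Q = inv_mat[OF Q_carrier det_Q]

lemma Q_q:
  assumes "i < n" "k < n"
  shows "(deg i + 2) * q i k - (\<Sum>w\<in>{w \<in> {0..<n}. E2 i w}. q w k) = (if i = k then 1 else 0)"
proof -
  have "(QG * inv_mat QG) $$ (i, k) = (if i = k then 1 else 0)"
    using inv_Q(2) assms by simp
  then have "(\<Sum>j<n. QG $$ (i, j) * q j k) = (if i = k then 1 else 0)"
    using mult_mat_entry[OF Q_carrier inv_Q(1) assms] by (simp add: q_def)
  then show ?thesis
    using Q_apply[OF assms(1), of "\<lambda>j. q j k"] by (simp add: lap_altdef algebra_simps)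
qed

lemma Q_row_sum: "i < n \<Longrightarrow> (\<Sum>j<n. QG $$ (i, j)) = 2"
  using Q_apply[of i "\<lambda>_. 1"] by (simp add: lap_def)

text \<open>L annihilates constants, so the all-ones vector is an eigenvector of Q for 2 and of its
  inverse for 1/2.\<close>

lemma q_row_sum:
  assumes "i < n"
  shows "(\<Sum>v<n. q i v) = 1 / 2"
proof -
  have "1 = (\<Sum>k<n. (inv_mat QG * QG) $$ (i, k))"
    using inv_Q(3) assms by (simp add: sum.delta)
  also have "\<dots> = (\<Sum>k<n. \<Sum>j<n. q i j * QG $$ (j, k))"
    using mult_mat_entry[OF inv_Q(1) Q_carrier assms] by (intro sum.cong) (simp_all add: q_def)
  also have "\<dots> = (\<Sum>j<n. q i j * (\<Sum>k<n. QG $$ (j, k)))"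
    by (subst sum.swap) (simp add: sum_distrib_left)
  also have "\<dots> = 2 * (\<Sum>j<n. q i j)"
    using Q_row_sum by (simp add: sum_distrib_left algebra_simps)
  finally show ?thesis by simp
qed

text \<open>Follows from the other one-sided inverse identity and the symmetry of \<open>QG\<close>,
  which spares a proof that the inverse is symmetric.\<close>

lemma q_col_sum:
  assumes "k < n"
  shows "(\<Sum>u<n. q u k) = 1 / 2"
proof -
  have "1 = (\<Sum>i<n. (QG * inv_mat QG) $$ (i, k))"
    using inv_Q(2) assms by (simp add: sum.delta)
  also have "\<dots> = (\<Sum>i<n. \<Sum>j<n. QG $$ (i, j) * q j k)"
    using mult_mat_entry[OF Q_carrier inv_Q(1) _ assms] by (intro sum.cong) (simp_all add: q_def)
  also have "\<dots> = (\<Sum>j<n. \<Sum>i<n. QG $$ (j, i) * q j k)"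
    using Q_sym by (subst sum.swap) (intro sum.cong; simp)
  also have "\<dots> = (\<Sum>j<n. (\<Sum>i<n. QG $$ (j, i)) * q j k)"
    by (simp add: sum_distrib_right)
  also have "\<dots> = 2 * (\<Sum>j<n. q j k)"
    using Q_row_sum by (simp add: sum_distrib_left)
  finally show ?thesis by simp
qed

section \<open>Vertices, neighbourhoods and Laplacian of the corona\<close>

lemma CV_eq: "CV = V1 \<times> insert None (Some ` ({..<n} <+> EE))"
  by (auto simp: corona_sub_V_def)

lemma finite_CV: "finite CV"
  using simple_graphD(1)[OF G1] finEE by (simp add: CV_eq)

lemma sum_CV:
  fixes F :: "_ \<Rightarrow> real"
  shows "(\<Sum>p\<in>CV. F p) = (\<Sum>i\<in>V1. F (hub i) + (\<Sum>v<n. F (orig i v)) + (\<Sum>e\<in>EE. F (subd i e)))"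
proof -
  have "(\<Sum>p\<in>CV. F p) = (\<Sum>i\<in>V1. \<Sum>a\<in>insert None (Some ` ({..<n} <+> EE)). F (i, a))"
    by (simp only: CV_eq sum.cartesian_product case_prod_eta)
  then show ?thesis
    using finEE by (simp add: sum.reindex sum.Plus add.assoc)
qed

lemma card_CV: "real (card CV) = real (card V1) * (1 + real n + real (card EE))"
  using sum_CV[of "\<lambda>_. 1"] by simp

lemma simple_CE: "simple_graph CV CE"
  using finite_CV simple_graphD[OF G1] edge_less
  unfolding simple_graph_def corona_sub_V_def corona_sub_E_def by auto

lemma nbrs_hub:
  assumes "i \<in> V1"
  shows "{p \<in> CV. CE (hub i) p} = hub ` {j \<in> V1. E1 i j} \<union> orig i ` {..<n}"
  using assms by (auto simp: corona_sub_V_def corona_sub_E_def)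

lemma nbrs_orig:
  assumes "i \<in> V1" "v < n"
  shows "{p \<in> CV. CE (orig i v) p} = insert (hub i) (subd i ` {e \<in> EE. v \<in> e})"
  using assms by (auto simp: corona_sub_V_def corona_sub_E_def)

lemma nbrs_subd:
  assumes "i \<in> V1" "e \<in> EE"
  shows "{p \<in> CV. CE (subd i e) p} = orig i ` e"
  using assms edge_less by (auto simp: corona_sub_V_def corona_sub_E_def)

lemma lap_hub:
  assumes "i \<in> V1"
  shows "lap CV CE x (hub i) =
    lap V1 E1 (\<lambda>j. x (hub j)) i + (\<Sum>v<n. x (hub i) - x (orig i v))"
proof -
  have "lap CV CE x (hub i) = (\<Sum>y\<in>hub ` {j \<in> V1. E1 i j}. x (hub i) - x y)
      + (\<Sum>y\<in>orig i ` {..<n}. x (hub i) - x y)"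
    unfolding lap_def nbrs_hub[OF assms]
    by (rule sum.union_disjoint) (use simple_graphD(1)[OF G1] in auto)
  then show ?thesis by (simp add: lap_def sum.reindex inj_on_def)
qed

lemma lap_orig:
  assumes "i \<in> V1" "v < n"
  shows "lap CV CE x (orig i v) =
    (x (orig i v) - x (hub i)) + (\<Sum>e\<in>{e \<in> EE. v \<in> e}. x (orig i v) - x (subd i e))"
  unfolding lap_def nbrs_orig[OF assms] using finEE
  by (subst sum.insert) (auto simp: sum.reindex inj_on_def)

lemma lap_subd:
  assumes "i \<in> V1" "e \<in> EE"
  shows "lap CV CE x (subd i e) = (\<Sum>u\<in>e. x (subd i e) - x (orig i u))"
  unfolding lap_def nbrs_subd[OF assms] by (simp add: sum.reindex inj_on_def)

text \<open>The inverse of the Laplacian of one copy grounded at its hub. By Schur complement with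
  respect to the subdivision vertices, the block on the original vertices is
  \<open>(D + I - R R\<^sup>T / 2)\<^sup>-\<^sup>1 = 2 Q\<^sup>-\<^sup>1\<close>, where \<open>R\<close> is the incidence matrix of \<open>G\<^sub>2\<close>;
  the remaining blocks follow from it.\<close>

fun copy_green :: "(nat + nat set) option \<Rightarrow> (nat + nat set) option \<Rightarrow> real" where
  "copy_green None b = 0"
| "copy_green a None = 0"
| "copy_green (Some (Inl u)) (Some (Inl v)) = 2 * q u v"
| "copy_green (Some (Inl u)) (Some (Inr f)) = (\<Sum>v\<in>f. q u v)"
| "copy_green (Some (Inr e)) (Some (Inl v)) = (\<Sum>u\<in>e. q u v)"
| "copy_green (Some (Inr e)) (Some (Inr f)) =
     (if e = f then 1 / 2 else 0) + 1 / 2 * (\<Sum>u\<in>e. \<Sum>v\<in>f. q u v)"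

lemma copy_green_None [simp]: "copy_green a None = 0"
  by (cases "(a, None :: (nat + nat set) option)" rule: copy_green.cases) auto

text \<open>The Laplacian equation at a subdivision vertex, which has degree 2, solved for its own
  potential: half the injected current plus the mean of the potentials at the two ends.\<close>

lemma copy_green_subd:
  "copy_green (Some (Inr e)) b =
     (if Some (Inr e) = b then 1 / 2 else 0) + 1 / 2 * (\<Sum>u\<in>e. copy_green (Some (Inl u)) b)"
proof (cases b)
  case (Some c)
  then show ?thesis by (cases c) (auto simp: sum_distrib_left)
qed simp

definition copies :: "(nat + nat set) option set" where
  "copies = {None} \<union> (Some \<circ> Inl) ` {..<n} \<union> (Some \<circ> Inr) ` EE"

lemma CV_mem: "(i, a) \<in> CV \<longleftrightarrow> i \<in> V1 \<and> a \<in> copies"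
  by (auto simp: corona_sub_V_def copies_def)

text \<open>Conservation of current: the unit injected at \<open>b\<close> reaches the grounded hub
  through the edges from the original vertices, and each of these edges carries the potential of its
  original end.\<close>

lemma copy_green_col_sum:
  assumes "b \<in> copies"
  shows "(\<Sum>u<n. copy_green (Some (Inl u)) b) = (if b = None then 0 else 1)"
  using assms unfolding copies_def
proof (elim UnE imageE, goal_cases)
  case (2 v)
  then show ?case by (simp add: sum_distrib_left[symmetric] q_col_sum)
next
  case (3 f)
  have "(\<Sum>u<n. \<Sum>v\<in>f. q u v) = (\<Sum>v\<in>f. \<Sum>u<n. q u v)" by (rule sum.swap)
  also have "\<dots> = 1" using 3 edge_less card_edge by (simp add: q_col_sum)
  finally show ?case using 3 by simp
qed simp

text \<open>Entrywise form of R R^T = D + A, the signless Laplacian of G2.\<close>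

lemma incident_subd_sum:
  fixes g :: "nat \<Rightarrow> real"
  assumes "v < n"
  shows "(\<Sum>e\<in>{e \<in> EE. v \<in> e}. \<Sum>u\<in>e. g u) = deg v * g v + (\<Sum>w\<in>{w \<in> {0..<n}. E2 v w}. g w)"
proof -
  have "(\<Sum>e\<in>{e \<in> EE. v \<in> e}. \<Sum>u\<in>e. g u) = (\<Sum>w\<in>{w \<in> {0..<n}. E2 v w}. \<Sum>u\<in>{v, w}. g u)"
    by (rule sum_incident_edges[OF G2]) (use assms in simp)
  also have "\<dots> = (\<Sum>w\<in>{w \<in> {0..<n}. E2 v w}. g v + g w)"
    by (intro sum.cong refl sum_graph_edge[OF G2]) auto
  finally show ?thesis by (simp add: sum.distrib degree_def)
qed

text \<open>The Laplacian equation at an original vertex, whose neighbours are \<open>deg v\<close>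
  subdivision vertices and the hub at potential 0. Substituting \<open>copy_green_subd\<close> turns
  the left side into half of Q applied to column \<open>b\<close>, minus 1/2 if \<open>b\<close> is
  an edge at \<open>v\<close>.\<close>

lemma copy_green_orig:
  assumes v: "v < n" and b: "b \<in> copies"
  shows "(deg v + 1) * copy_green (Some (Inl v)) b
      - (\<Sum>e\<in>{e \<in> EE. v \<in> e}. copy_green (Some (Inr e)) b) = (if b = Some (Inl v) then 1 else 0)"
proof -
  let ?k = "\<lambda>u. copy_green (Some (Inl u)) b"
  let ?S = "{e \<in> EE. v \<in> e}"
  have "(\<Sum>e\<in>?S. copy_green (Some (Inr e)) b) =
      (\<Sum>e\<in>?S. if Some (Inr e) = b then 1 / 2 else 0) + 1 / 2 * (\<Sum>e\<in>?S. \<Sum>u\<in>e. ?k u)"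
    by (simp add: copy_green_subd sum.distrib sum_distrib_left)
  then have eq: "(deg v + 1) * ?k v - (\<Sum>e\<in>?S. copy_green (Some (Inr e)) b) =
      1 / 2 * ((deg v + 2) * ?k v - (\<Sum>w\<in>{w \<in> {0..<n}. E2 v w}. ?k w))
      - (\<Sum>e\<in>?S. if Some (Inr e) = b then 1 / 2 else 0)"
    by (simp add: incident_subd_sum[OF v] field_simps)
  show ?thesis
    using b unfolding eq copies_def
  proof (elim UnE imageE, goal_cases)
    case (2 w)
    then show ?case using Q_q[OF v, of w] by (simp add: sum_distrib_left[symmetric] algebra_simps)
  next
    \<comment> \<open>Q applied to column \<open>f\<close> gives the indicator of \<open>v\<close>
      in \<open>f\<close>; its half cancels the 1/2 coming from the source at
      \<open>f\<close>.\<close>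
    case (3 f)
    have "(deg v + 2) * (\<Sum>w\<in>f. q v w) - (\<Sum>u\<in>{u \<in> {0..<n}. E2 v u}. \<Sum>w\<in>f. q u w) =
      (\<Sum>w\<in>f. (deg v + 2) * q v w - (\<Sum>u\<in>{u \<in> {0..<n}. E2 v u}. q u w))"
      by (subst sum.swap) (simp add: sum_subtractf sum_distrib_left)
    also have "\<dots> = (\<Sum>w\<in>f. if v = w then 1 else 0)"
      using 3 edge_less by (intro sum.cong Q_q[OF v]) auto
    also have "\<dots> = (if v \<in> f then 1 else 0)"
      using 3 card_edge[of f] by (subst sum.delta') (auto intro: card_ge_0_finite)
    finally show ?case using 3 finEE by (auto simp: sum.delta)
  qed simp
qed

text \<open>The X-part is constant on each copy, so its Laplacian lives on the hubs. The K-part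
  produces the delta inside a copy and, by \<open>copy_green_col_sum\<close>, a -1 at its hub that
  cancels the delta of X there. For a source at a hub K vanishes and the delta of X stays.\<close>

lemma green_corona:
  assumes X: "green V1 E1 X"
  shows "green CV CE (\<lambda>p r. X (fst p) (fst r) +
    (if fst p = fst r then copy_green (snd p) (snd r) else 0))"
proof -
  from X obtain h where h: "\<And>i j. i \<in> V1 \<Longrightarrow> j \<in> V1 \<Longrightarrow>
      lap V1 E1 (\<lambda>v. X v j) i = (if i = j then 1 else 0) - h i"
    unfolding green_def by blast
  \<comment> \<open>The source \<open>r\<close> comes first, so that \<open>?G r\<close> is the
    potential to which \<open>lap\<close> is applied.\<close>
  let ?G = "\<lambda>r p. X (fst p) (fst r) + (if fst p = fst r then copy_green (snd p) (snd r) else 0)"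
  let ?h = "\<lambda>p. if snd p = None then h (fst p) else 0"
  have "lap CV CE (?G r) p = (if p = r then 1 else 0) - ?h p" if pr: "p \<in> CV" "r \<in> CV" for p r
  proof -
    obtain j b where r: "r = (j, b)" and j: "j \<in> V1" and b: "b \<in> copies"
      using pr(2) CV_mem by (cases r) auto
    obtain i a where p: "p = (i, a)" and i: "i \<in> V1" and a: "a \<in> copies"
      using pr(1) CV_mem by (cases p) auto
    from a consider "a = None" | v where "a = Some (Inl v)" "v < n" | e where "a = Some (Inr e)" "e \<in> EE"
      unfolding copies_def by auto
    then show ?thesis
    proof cases
      case 1
      have "lap CV CE (?G r) p = lap V1 E1 (\<lambda>k. X k j) i
          - (if i = j then \<Sum>v<n. copy_green (Some (Inl v)) b else 0)"
        unfolding p r 1 lap_hub[OF i] fst_conv snd_conv copy_green.simps(1) if_cancel add_0_right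
        by (simp add: sum_negf)
      then show ?thesis
        unfolding copy_green_col_sum[OF b] h[OF i j] by (simp add: p r 1)
    next
      case 2
      have "lap CV CE (?G r) p = (if i = j then (deg v + 1) * copy_green (Some (Inl v)) b
          - (\<Sum>e\<in>{e \<in> EE. v \<in> e}. copy_green (Some (Inr e)) b) else 0)"
        unfolding p r 2(1) lap_orig[OF i 2(2)] fst_conv snd_conv copy_green.simps(1)
        using card_incident[OF 2(2)] by (simp add: sum_subtractf algebra_simps del: copy_green.simps)
      then show ?thesis
        unfolding copy_green_orig[OF 2(2) b] by (auto simp: p r 2)
    next
      case 3
      have "lap CV CE (?G r) p = (if i = j then 2 * copy_green (Some (Inr e)) b
          - (\<Sum>u\<in>e. copy_green (Some (Inl u)) b) else 0)"
        unfolding p r 3(1) lap_subd[OF i 3(2)] fst_conv snd_conv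
        using card_edge[OF 3(2)] by (simp add: sum_subtractf del: copy_green.simps)
      then show ?thesis
        unfolding copy_green_subd[of e b] by (auto simp: p r 3 simp del: copy_green.simps)
    qed
  qed
  then show ?thesis unfolding green_def by (intro exI[of _ ?h] ballI)
qed

abbreviation sum_copy :: "((nat + nat set) option \<Rightarrow> real) \<Rightarrow> real" where
  "sum_copy F \<equiv> F None + (\<Sum>v<n. F (Some (Inl v))) + (\<Sum>e\<in>EE. F (Some (Inr e)))"

text \<open>The projection to \<open>V1\<close> has fibres of size N = 1 + n + m, and K fills
  \<open>card V1\<close> diagonal blocks. As \<open>card CV\<close> is N times
  \<open>card V1\<close>, both X-terms acquire the factor N^2 and regroup by
  \<open>kirchhoff_green\<close> for G1.\<close>

lemma kirchhoff_corona:
  assumes X: "green V1 E1 X"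
  shows "kirchhoff CV CE = (1 + real n + real (card EE)) ^ 2 * kirchhoff V1 E1
    + real (card V1) ^ 2 * (1 + real n + real (card EE)) * sum_copy (\<lambda>a. copy_green a a)
    - real (card V1) * sum_copy (\<lambda>a. sum_copy (copy_green a))"
proof -
  note fin = simple_graphD(1)[OF G1]
  define G where "G = (\<lambda>p r. X (fst p) (fst r) +
    (if fst p = fst r then copy_green (snd p) (snd r) else 0))"
  let ?N = "1 + real n + real (card EE)"
  have tr: "(\<Sum>p\<in>CV. G p p) = ?N * (\<Sum>i\<in>V1. X i i) + real (card V1) * sum_copy (\<lambda>a. copy_green a a)"
    by (simp add: G_def sum_CV sum.distrib sum_distrib_left sum_distrib_right algebra_simps)
  have row: "(\<Sum>r\<in>CV. G (i, a) r) = ?N * (\<Sum>j\<in>V1. X i j) + sum_copy (copy_green a)"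
    if "i \<in> V1" for i a
  proof -
    have "(\<Sum>r\<in>CV. G (i, a) r) =
        (\<Sum>j\<in>V1. ?N * X i j + (if i = j then sum_copy (copy_green a) else 0))"
      unfolding sum_CV by (intro sum.cong) (auto simp: G_def sum.distrib algebra_simps)
    then show ?thesis using that fin
      by (simp add: sum.distrib sum_distrib_left[symmetric] sum.delta')
  qed
  define T where "T = sum_copy (\<lambda>a. sum_copy (copy_green a))"
  have "(\<Sum>p\<in>CV. \<Sum>r\<in>CV. G p r) = (\<Sum>i\<in>V1. ?N * (?N * (\<Sum>j\<in>V1. X i j)) + T)"
    unfolding sum_CV[of "\<lambda>p. \<Sum>r\<in>CV. G p r"] T_def
    by (intro sum.cong refl) (simp only: row sum.distrib sum_constant card_lessThan, simp add: algebra_simps)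
  also have "\<dots> = ?N ^ 2 * (\<Sum>i\<in>V1. \<Sum>j\<in>V1. X i j) + real (card V1) * T"
    by (simp add: sum.distrib sum_distrib_left[symmetric] power2_eq_square)
  finally have all: "(\<Sum>p\<in>CV. \<Sum>r\<in>CV. G p r) =
      ?N ^ 2 * (\<Sum>i\<in>V1. \<Sum>j\<in>V1. X i j) + real (card V1) * T" .
  have "kirchhoff CV CE = real (card CV) * (\<Sum>p\<in>CV. G p p) - (\<Sum>p\<in>CV. \<Sum>r\<in>CV. G p r)"
    unfolding G_def by (rule kirchhoff_green[OF simple_CE green_corona[OF X]])
  then show ?thesis
    unfolding tr all card_CV kirchhoff_green[OF G1 X] T_def[symmetric]
    by (simp only: algebra_simps power2_eq_square)
qed

section \<open>Trace and total of the grounded inverse in terms of Q\<close>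

lemma trace_adj: "mat_trace (inv_mat QG * adj_mat n E2) = (\<Sum>u<n. \<Sum>w\<in>{w \<in> {0..<n}. E2 u w}. q u w)"
proof -
  have A: "adj_mat n E2 \<in> carrier_mat n n" by (simp add: adj_mat_def)
  have "mat_trace (inv_mat QG * adj_mat n E2) = (\<Sum>u<n. \<Sum>w<n. if E2 u w then q u w else 0)"
    using mult_mat_entry[OF inv_Q(1) A] inv_Q(1) simple_graphD(4)[OF G2]
    by (auto simp: mat_trace_def adj_mat_def q_def intro!: sum.cong)
  then show ?thesis by (simp only: sum_nbrs)
qed

lemma trace_deg: "mat_trace (inv_mat QG * deg_mat n E2) = (\<Sum>u<n. deg u * q u u)"
proof -
  have D: "deg_mat n E2 \<in> carrier_mat n n" by (simp add: deg_mat_def)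
  have "mat_trace (inv_mat QG * deg_mat n E2) = (\<Sum>u<n. \<Sum>w<n. q u w * (if w = u then deg w else 0))"
    using mult_mat_entry[OF inv_Q(1) D] inv_Q(1)
    by (auto simp: mat_trace_def deg_mat_def q_def intro!: sum.cong)
  then show ?thesis by (simp add: if_distrib sum.delta mult.commute cong: if_cong)
qed

lemma trace_inv_Q: "mat_trace (inv_mat QG) = (\<Sum>u<n. q u u)"
  using inv_Q(1) by (simp add: mat_trace_def q_def)

lemma deg_quadratic_form:
  "deg_vec n E2 \<bullet> (inv_mat QG *\<^sub>v deg_vec n E2) = (\<Sum>u<n. deg u * (\<Sum>v<n. deg v * q u v))"
  using inv_Q(1)
  by (auto simp: deg_vec_def scalar_prod_def q_def lessThan_atLeast0 mult.commute intro!: sum.cong)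

text \<open>The original block is 2 Q^-1. The subdivision block is I / 2 + R^T Q^-1 R / 2, and
  moving R around the trace turns R R^T into D + A.\<close>

lemma copy_green_trace:
  "sum_copy (\<lambda>a. copy_green a a) = 2 * mat_trace (inv_mat QG) + real (card EE) / 2
    + 1 / 2 * (mat_trace (inv_mat QG * adj_mat n E2) + mat_trace (inv_mat QG * deg_mat n E2))"
proof -
  have "(\<Sum>e\<in>EE. \<Sum>u\<in>e. \<Sum>v\<in>e. q u v) = (\<Sum>u\<in>{0..<n}. \<Sum>w\<in>{w \<in> {0..<n}. E2 u w}. \<Sum>v\<in>{u, w}. q u v)"
    by (rule sum_edges_endpoints[OF G2])
  also have "\<dots> = (\<Sum>u\<in>{0..<n}. \<Sum>w\<in>{w \<in> {0..<n}. E2 u w}. q u u + q u w)"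
    by (intro sum.cong refl sum_graph_edge[OF G2]) auto
  also have "\<dots> = mat_trace (inv_mat QG * deg_mat n E2) + mat_trace (inv_mat QG * adj_mat n E2)"
    by (simp add: trace_adj trace_deg sum.distrib degree_def lessThan_atLeast0)
  finally show ?thesis
    by (simp add: trace_inv_Q sum.distrib sum_distrib_left[symmetric] sum_divide_distrib[symmetric])
qed

text \<open>R maps the all-ones vector to the degree vector, and Q^-1 has row and column sums 1/2.
  The original block therefore gives n, each mixed block half the degree sum, that is m, and the
  subdivision block m / 2 plus half the quadratic form; hence 5/2.\<close>

lemma copy_green_total:
  "sum_copy (\<lambda>a. sum_copy (copy_green a)) = real n + 5 / 2 * real (card EE)
    + 1 / 2 * (deg_vec n E2 \<bullet> (inv_mat QG *\<^sub>v deg_vec n E2))"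
proof -
  have oo: "(\<Sum>u<n. \<Sum>v<n. q u v) = real n / 2" by (simp add: q_row_sum)
  have os: "(\<Sum>u<n. \<Sum>e\<in>EE. \<Sum>v\<in>e. q u v) = real (card EE)"
  proof -
    have "(\<Sum>u<n. \<Sum>e\<in>EE. \<Sum>v\<in>e. q u v) = (\<Sum>v<n. \<Sum>u<n. deg v * q u v)"
      unfolding sum_edges_ends by (rule sum.swap)
    also have "\<dots> = 1 / 2 * (\<Sum>v<n. deg v)"
      by (simp add: sum_distrib_left[symmetric] q_col_sum sum_divide_distrib)
    finally show ?thesis by (simp add: sum_deg)
  qed
  have so: "(\<Sum>e\<in>EE. \<Sum>v<n. \<Sum>u\<in>e. q u v) = real (card EE)"
  proof -
    have "(\<Sum>e\<in>EE. \<Sum>v<n. \<Sum>u\<in>e. q u v) = (\<Sum>e\<in>EE. \<Sum>u\<in>e. \<Sum>v<n. q u v)"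
      by (intro sum.cong refl sum.swap)
    also have "\<dots> = (\<Sum>u<n. deg u * (\<Sum>v<n. q u v))" by (rule sum_edges_ends)
    also have "\<dots> = 1 / 2 * (\<Sum>u<n. deg u)" by (simp add: q_row_sum sum_divide_distrib)
    finally show ?thesis by (simp add: sum_deg)
  qed
  have ss: "(\<Sum>e\<in>EE. \<Sum>f\<in>EE. \<Sum>u\<in>e. \<Sum>v\<in>f. q u v) = (\<Sum>u<n. deg u * (\<Sum>v<n. deg v * q u v))"
  proof -
    have "(\<Sum>e\<in>EE. \<Sum>f\<in>EE. \<Sum>u\<in>e. \<Sum>v\<in>f. q u v) = (\<Sum>e\<in>EE. \<Sum>u\<in>e. \<Sum>f\<in>EE. \<Sum>v\<in>f. q u v)"
      by (intro sum.cong refl sum.swap)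
    then show ?thesis by (simp only: sum_edges_ends)
  qed
  have o: "sum_copy (copy_green (Some (Inl u))) = 2 * (\<Sum>v<n. q u v) + (\<Sum>e\<in>EE. \<Sum>v\<in>e. q u v)"
    for u
    by (simp add: sum_distrib_left)
  have s: "sum_copy (copy_green (Some (Inr e))) =
      (\<Sum>v<n. \<Sum>u\<in>e. q u v) + 1 / 2 + 1 / 2 * (\<Sum>f\<in>EE. \<Sum>u\<in>e. \<Sum>v\<in>f. q u v)"
    if "e \<in> EE" for e
    using that finEE by (simp add: sum.distrib sum.delta' sum_divide_distrib)
  have "sum_copy (\<lambda>a. sum_copy (copy_green a)) =
      (\<Sum>u<n. sum_copy (copy_green (Some (Inl u)))) + (\<Sum>e\<in>EE. sum_copy (copy_green (Some (Inr e))))"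
    by simp
  also have "\<dots> = (\<Sum>u<n. 2 * (\<Sum>v<n. q u v) + (\<Sum>e\<in>EE. \<Sum>v\<in>e. q u v))
      + (\<Sum>e\<in>EE. (\<Sum>v<n. \<Sum>u\<in>e. q u v) + 1 / 2 + 1 / 2 * (\<Sum>f\<in>EE. \<Sum>u\<in>e. \<Sum>v\<in>f. q u v))"
    by (intro arg_cong2[where f = "(+)"] sum.cong refl o s)
  also have "\<dots> = 2 * (\<Sum>u<n. \<Sum>v<n. q u v)
      + (\<Sum>u<n. \<Sum>e\<in>EE. \<Sum>v\<in>e. q u v) + (\<Sum>e\<in>EE. \<Sum>v<n. \<Sum>u\<in>e. q u v)
      + real (card EE) / 2 + 1 / 2 * (\<Sum>e\<in>EE. \<Sum>f\<in>EE. \<Sum>u\<in>e. \<Sum>v\<in>f. q u v)"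
    by (simp add: sum.distrib sum_distrib_left[symmetric] sum_divide_distrib[symmetric])
  also have "\<dots> = real n + 5 / 2 * real (card EE)
      + 1 / 2 * (deg_vec n E2 \<bullet> (inv_mat QG *\<^sub>v deg_vec n E2))"
    unfolding oo os so ss deg_quadratic_form by simp
  finally show ?thesis .
qed

end

theorem theorem4p1:
  fixes V1 :: "'a set" and E1 :: "'a \<Rightarrow> 'a \<Rightarrow> bool"
    and n2 :: nat and E2 :: "nat \<Rightarrow> nat \<Rightarrow> bool" and \<mu> :: "real list"
  assumes G1: "connected_graph V1 E1"
    and G2: "simple_graph {0..<n2} E2"
    and eig: "char_poly (lap_mat n2 E2) = (\<Prod>a\<leftarrow>\<mu>. [:- a, 1:])"
  defines "n1 \<equiv> real (card V1)"
    and "m2 \<equiv> real (card (graph_edges {0..<n2} E2))"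
    and "Q \<equiv> lap_mat n2 E2 + 2 \<cdot>\<^sub>m 1\<^sub>m n2"
    and "\<pi> \<equiv> deg_vec n2 E2"
  shows "kirchhoff (corona_sub_V V1 n2 E2) (corona_sub_E V1 E1 n2 E2)
    = n1 * (1 + real n2 + m2) *
        (n1 * m2 / 2
         + n1 / 2 * (mat_trace (inv_mat Q * adj_mat n2 E2) + mat_trace (inv_mat Q * deg_mat n2 E2))
         + 2 * n1 * (\<Sum>a\<leftarrow>\<mu>. 1 / (a + 2))
         + (m2 + real n2 + 1) / n1 * kirchhoff V1 E1)
      - n1 / 2 * (\<pi> \<bullet> (inv_mat Q *\<^sub>v \<pi>))
      - (5 * n1 * m2 + 2 * n1 * real n2) / 2"
proof -
  interpret corona_sub V1 E1 n2 E2
    using G1 G2 by unfold_locales (simp_all add: connected_graph_def)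
  have n1: "n1 \<noteq> 0"
    using assms(1) by (auto simp: n1_def connected_graph_def simple_graph_def)
  obtain X where X: "green V1 E1 X" using green_exists[OF assms(1)] .
  have tr: "mat_trace (inv_mat Q) = (\<Sum>a\<leftarrow>\<mu>. 1 / (a + 2))"
    unfolding Q_def
    by (rule mat_trace_inv_shift[OF _ eig det_Q[unfolded QG_def]])
      (auto simp: lap_mat_def deg_mat_def adj_mat_def intro: minus_carrier_mat)
  \<comment> \<open>Writing the Kirchhoff index of G1 as a multiple of \<open>n1\<close> removes the
    division by \<open>n1\<close>, so that the final comparison is a polynomial identity.\<close>
  define k where "k = kirchhoff V1 E1 / n1"
  have k: "kirchhoff V1 E1 = n1 * k" "x / n1 * (n1 * k) = x * k" for x
    using n1 by (simp_all add: k_def)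
  show ?thesis
    unfolding kirchhoff_corona[OF X] copy_green_trace copy_green_total
    unfolding QG_def Q_def[symmetric] \<pi>_def[symmetric] n1_def[symmetric] m2_def[symmetric] tr k
    by (simp add: algebra_simps power2_eq_square add_divide_distrib)
qed

end
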